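(* Let $n\ge1$, $0<\alpha<1$, let $\Omega\subset\mathbb{R}^n$ be a bounded domain, and let $f\in C(\Omega)$ be bounded with $f\le0$. Let $u$ be a viscosity supersolution and $v$ a viscosity subsolution to $\mathcal{L}_\infty w=f$ in $\Omega$. Assume that $u$ is bounded on $\mathbb{R}^n\setminus\Omega$, that $u\ge v$ on $\mathbb{R}^n\setminus\Omega$, and that the limits $\lim_{|x|\to\infty}u(x)=C_1$ and $\lim_{|x|\to\infty}v(x)=C_2$ exist (as finite real numbers). Then $u\ge v$ in $\Omega$.
   Context: For $0<\alpha\le1$ and a function $\varphi:\mathbb{R}^n\to\mathbb{R}$, the nonlocal infinity Laplacian is $\mathcal{L}_\infty\varphi(x)=\mathcal{L}^+_\infty\varphi(x)+\mathcal{L}^-_\infty\varphi(x)$, where $\mathcal{L}^+_\infty\varphi(x)=\sup_{y\in\mathbb{R}^n}\frac{\varphi(y)-\varphi(x)}{|x-y|^\alpha}$ and $\mathcal{L}^-_\infty\varphi(x)=\inf_{y\in\mathbb{R}^n}\frac{\varphi(y)-\varphi(x)}{|x-y|^\alpha}$ (with $y\neq x$). Viscosity supersolution: a lower semicontinuous $u:\mathbb{R}^n\to\mathbb{R}$ with $|u(x)|\le C(1+|x|)^\beta$ for some $C>0$, $\beta<\alpha$, is a viscosity supersolution to $\mathcal{L}_\infty u=f$ in $\Omega$ if for every $x_0\in\Omega$ and every locally Lipschitz continuous $\varphi:\mathbb{R}^n\to\mathbb{R}$ with $|\varphi(x)|\le C(1+|x|)^\beta$ for some $C>0$, $\beta<\alpha$,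 such that $\varphi(x_0)=u(x_0)$ and $u\ge\varphi$ on $\mathbb{R}^n$, one has $\mathcal{L}_\infty\varphi(x_0)\le f(x_0)$. Viscosity subsolutions are defined analogously with $u$ upper semicontinuous, $u\le\varphi$ on $\mathbb{R}^n$, and $\mathcal{L}_\infty\varphi(x_0)\ge f(x_0)$. *)

theory Defs
  imports "HOL-Analysis.Analysis"
begin

definition growth_ok :: "real \<Rightarrow> ('a::euclidean_space \<Rightarrow> real) \<Rightarrow> bool" where
  "growth_ok \<alpha> u \<longleftrightarrow> (\<exists>C>0. \<exists>\<beta><\<alpha>. \<forall>x. \<bar>u x\<bar> \<le> C * (1 + norm x) powr \<beta>)"

definition loc_lipschitz :: "('a::euclidean_space \<Rightarrow> real) \<Rightarrow> bool" where
  "loc_lipschitz \<phi> \<longleftrightarrow> (\<forall>x. \<exists>e>0. \<exists>L. L-lipschitz_on (ball x e) \<phi>)"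

definition Lplus :: "real \<Rightarrow> ('a::euclidean_space \<Rightarrow> real) \<Rightarrow> 'a \<Rightarrow> real" where
  "Lplus \<alpha> \<phi> x = (SUP y\<in>UNIV - {x}. (\<phi> y - \<phi> x) / norm (x - y) powr \<alpha>)"

definition Lminus :: "real \<Rightarrow> ('a::euclidean_space \<Rightarrow> real) \<Rightarrow> 'a \<Rightarrow> real" where
  "Lminus \<alpha> \<phi> x = (INF y\<in>UNIV - {x}. (\<phi> y - \<phi> x) / norm (x - y) powr \<alpha>)"

definition Linf :: "real \<Rightarrow> ('a::euclidean_space \<Rightarrow> real) \<Rightarrow> 'a \<Rightarrow> real" where
  "Linf \<alpha> \<phi> x = Lplus \<alpha> \<phi> x + Lminus \<alpha> \<phi> x"

definition lsc :: "('a::topological_space \<Rightarrow> real) \<Rightarrow> bool" where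
  "lsc u \<longleftrightarrow> (\<forall>t. open {x. u x > t})"

definition usc :: "('a::topological_space \<Rightarrow> real) \<Rightarrow> bool" where
  "usc u \<longleftrightarrow> (\<forall>t. open {x. u x < t})"

definition visc_super :: "real \<Rightarrow> 'a set \<Rightarrow> ('a \<Rightarrow> real) \<Rightarrow> ('a::euclidean_space \<Rightarrow> real) \<Rightarrow> bool" where
  "visc_super \<alpha> \<Omega> f u \<longleftrightarrow> lsc u \<and> growth_ok \<alpha> u \<and>
     (\<forall>x0\<in>\<Omega>. \<forall>\<phi>. loc_lipschitz \<phi> \<and> growth_ok \<alpha> \<phi> \<and> \<phi> x0 = u x0 \<and> (\<forall>x. u x \<ge> \<phi> x)
        \<longrightarrow> Linf \<alpha> \<phi> x0 \<le> f x0)"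

definition visc_sub :: "real \<Rightarrow> 'a set \<Rightarrow> ('a \<Rightarrow> real) \<Rightarrow> ('a::euclidean_space \<Rightarrow> real) \<Rightarrow> bool" where
  "visc_sub \<alpha> \<Omega> f u \<longleftrightarrow> usc u \<and> growth_ok \<alpha> u \<and>
     (\<forall>x0\<in>\<Omega>. \<forall>\<phi>. loc_lipschitz \<phi> \<and> growth_ok \<alpha> \<phi> \<and> \<phi> x0 = u x0 \<and> (\<forall>x. u x \<le> \<phi> x)
        \<longrightarrow> Linf \<alpha> \<phi> x0 \<ge> f x0)"

end

(* Minimise u(x) - v(y) + k|x - y| and let k tend to infinity. At a minimum (x, y) both functions are touched
   by Lipschitz cones, so the viscosity inequalities may be read off for u and v themselves, and all increments of
   u from x dominate those of v from y. Since f \<le> 0, the cusp u(x) - A|z - x|^alpha is a barrier: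
   its slope A need only be tested outside the domain, so that inf (u(z) - u(x))/|z - x|^alpha is
   (almost) attained at an exterior point. There v decreases by no more than u does, up to
   f(x) - f(y), which vanishes in the limit. A limit of these exterior points thus has u < v,
   contrary to the boundary condition, if u - v is negative somewhere. *)

theory Submission
  imports Defs
begin

section \<open>Powers of exponent at most one, and Lipschitz building blocks for test
  functions\<close>

text \<open>Scaling by \<open>b\<close> reduces this to the fact that a number at least 1 dominates
  its power \<open>\<alpha>\<close>. It makes a cusp Lipschitz away from its vertex.\<close>

lemma powr_diff_le:
  fixes a b \<alpha> :: real
  assumes "0 < b" "b \<le> a" "0 \<le> \<alpha>" "\<alpha> \<le> 1"
  shows "a powr \<alpha> - b powr \<alpha> \<le> b powr (\<alpha> - 1) * (a - b)"
proof -
  have "(a / b) powr \<alpha> \<le> (a / b) powr 1"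
    using assms by (intro powr_mono) auto
  then have "b powr \<alpha> * ((a / b) powr \<alpha> - 1) \<le> b powr \<alpha> * (a / b - 1)"
    using assms by (intro mult_left_mono) auto
  moreover have "b powr \<alpha> * ((a / b) powr \<alpha> - 1) = a powr \<alpha> - b powr \<alpha>"
    using assms by (simp add: powr_divide field_simps)
  moreover have "b powr \<alpha> * (a / b - 1) = b powr (\<alpha> - 1) * (a - b)"
    using assms by (simp add: powr_diff field_simps)
  ultimately show ?thesis by simp
qed

text \<open>The fractions \<open>a / (a + b)\<close> and \<open>b / (a + b)\<close> add up to 1 and
  lie in the unit interval, where a number is at most its power \<open>\<alpha>\<close>.\<close>

lemma powr_add_le:
  fixes a b \<alpha> :: real
  assumes "0 \<le> a" "0 \<le> b" "0 < \<alpha>" "\<alpha> \<le> 1"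
  shows "(a + b) powr \<alpha> \<le> a powr \<alpha> + b powr \<alpha>"
proof (cases "a + b = 0")
  case False
  then have pos: "0 < a + b" using assms by auto
  have *: "t \<le> t powr \<alpha>" if "0 \<le> t" "t \<le> 1" for t :: real
    using powr_mono'[of \<alpha> 1 t] that assms by simp
  have "a / (a + b) + b / (a + b) \<le> (a / (a + b)) powr \<alpha> + (b / (a + b)) powr \<alpha>"
    using pos assms by (intro add_mono *) auto
  moreover have "a / (a + b) + b / (a + b) = 1"
    using pos by (simp flip: add_divide_distrib)
  ultimately have "1 \<le> (a powr \<alpha> + b powr \<alpha>) / (a + b) powr \<alpha>"
    using pos assms by (simp add: powr_divide add_divide_distrib)
  then show ?thesis
    using pos by (simp add: pos_le_divide_eq)
qed (use assms in auto)

lemma lipschitz_on_max: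
  fixes g h :: "'a::metric_space \<Rightarrow> real"
  assumes "L-lipschitz_on X g" "M-lipschitz_on X h"
  shows "(max L M)-lipschitz_on X (\<lambda>x. max (g x) (h x))"
proof (rule lipschitz_onI)
  fix x y assume xy: "x \<in> X" "y \<in> X"
  have "dist (g x) (g y) \<le> L * dist x y" "dist (h x) (h y) \<le> M * dist x y"
    using assms xy by (auto dest: lipschitz_onD)
  moreover have "L * dist x y \<le> max L M * dist x y" "M * dist x y \<le> max L M * dist x y"
    by (auto intro: mult_right_mono)
  ultimately show "dist (max (g x) (h x)) (max (g y) (h y)) \<le> max L M * dist x y"
    unfolding dist_real_def by linarith
next
  show "0 \<le> max L M" using lipschitz_on_nonneg[OF assms(1)] by simp
qed

lemma lipschitz_on_cone:
  assumes "0 \<le> K"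
  shows "K-lipschitz_on X (\<lambda>x. c - K * norm (x - p))"
proof (rule lipschitz_onI)
  fix x y
  have "K * \<bar>norm (y - p) - norm (x - p)\<bar> \<le> K * norm (x - y)"
    using assms norm_triangle_ineq3[of "y - p" "x - p"]
    by (intro mult_left_mono) (auto simp: norm_minus_commute)
  moreover have "\<bar>K * norm (y - p) - K * norm (x - p)\<bar> = K * \<bar>norm (y - p) - norm (x - p)\<bar>"
    using assms by (simp add: abs_mult flip: right_diff_distrib)
  ultimately show "dist (c - K * norm (x - p)) (c - K * norm (y - p)) \<le> K * dist x y"
    by (simp add: dist_norm real_norm_def)
qed (use assms in auto)

text \<open>For \<open>\<alpha> < 1\<close> a cusp has infinite slope at its vertex. Replacing radii
  below \<open>r\<close> by \<open>r\<close> caps the slope of the power at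
  \<open>r powr (\<alpha> - 1)\<close>, so that it may enter a test function.\<close>

lemma lipschitz_on_blunt_cusp:
  fixes p :: "'a::euclidean_space"
  assumes "0 < r" "0 \<le> A" "0 \<le> \<alpha>" "\<alpha> \<le> 1"
  shows "(A * r powr (\<alpha> - 1))-lipschitz_on X (\<lambda>x. c - A * (max (norm (x - p)) r) powr \<alpha>)"
proof (rule lipschitz_onI)
  fix x y
  let ?m = "\<lambda>x. max (norm (x - p)) r"
  have aux: "\<bar>?m x powr \<alpha> - ?m y powr \<alpha>\<bar> \<le> r powr (\<alpha> - 1) * norm (x - y)"
    if "?m y \<le> ?m x" for x y
  proof -
    have "?m x powr \<alpha> - ?m y powr \<alpha> \<le> ?m y powr (\<alpha> - 1) * (?m x - ?m y)"
      using assms that by (intro powr_diff_le) auto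
    also have "\<dots> \<le> r powr (\<alpha> - 1) * norm (x - y)"
    proof (intro mult_mono)
      show "?m y powr (\<alpha> - 1) \<le> r powr (\<alpha> - 1)"
        using assms by (intro powr_mono2') auto
      show "?m x - ?m y \<le> norm (x - y)"
        using norm_triangle_ineq2[of "x - p" "y - p"] norm_ge_zero[of "x - y"]
        by (simp add: max_def del: norm_ge_zero)
    qed (use that in auto)
    finally show ?thesis
      using powr_mono2[of \<alpha> "?m y" "?m x"] assms that by auto
  qed
  have "\<bar>?m x powr \<alpha> - ?m y powr \<alpha>\<bar> \<le> r powr (\<alpha> - 1) * norm (x - y)"
    using aux[of x y] aux[of y x] by (cases "?m y \<le> ?m x") (auto simp: norm_minus_commute abs_minus_commute)
  then have "A * \<bar>?m x powr \<alpha> - ?m y powr \<alpha>\<bar> \<le> A * (r powr (\<alpha> - 1) * norm (x - y))"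
    using assms by (intro mult_left_mono) auto
  moreover have "\<bar>(c - A * ?m x powr \<alpha>) - (c - A * ?m y powr \<alpha>)\<bar> = A * \<bar>?m x powr \<alpha> - ?m y powr \<alpha>\<bar>"
    using assms by (simp add: abs_mult abs_minus_commute flip: right_diff_distrib)
  ultimately show "dist (c - A * ?m x powr \<alpha>) (c - A * ?m y powr \<alpha>) \<le> A * r powr (\<alpha> - 1) * dist x y"
    by (simp add: dist_norm real_norm_def mult.assoc)
qed (use assms in auto)

lemma lipschitz_imp_loc_lipschitz:
  assumes "L-lipschitz_on UNIV \<phi>"
  shows "loc_lipschitz \<phi>"
  unfolding loc_lipschitz_def
  using lipschitz_on_subset[OF assms] by (meson subset_UNIV zero_less_one)

lemma bounded_imp_growth_ok:
  assumes "0 < \<alpha>" "\<And>x. \<bar>\<phi> x\<bar> \<le> D"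
  shows "growth_ok \<alpha> \<phi>"
  unfolding growth_ok_def
proof (intro exI conjI allI)
  \<comment> \<open>The growth exponent is 0, which is below \<open>\<alpha>\<close>; adding 1 keeps
    the constant positive when \<open>D = 0\<close>.\<close>
  show "0 < D + 1" using assms(2)[of undefined] by linarith
  show "\<bar>\<phi> x\<bar> \<le> (D + 1) * (1 + norm x) powr 0" for x
    using assms(2)[of x] norm_ge_zero[of x] by (simp add: add_nonneg_eq_0_iff)
qed (use assms in auto)

text \<open>Up to distance 1 the Lipschitz bound suffices because
  \<open>t \<le> t powr \<alpha>\<close> there; beyond it the bound \<open>2 * D\<close> does.
  Bounded quotients make \<open>Lplus\<close> a true least upper bound rather than a default value
  of \<open>SUP\<close>.\<close>

lemma holder_quotient_bounded:
  assumes "0 < \<alpha>" "\<alpha> < 1" "L-lipschitz_on UNIV \<phi>" "\<And>x. \<bar>\<phi> x\<bar> \<le> D" "y \<noteq> x"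
  shows "\<bar>(\<phi> y - \<phi> x) / norm (x - y) powr \<alpha>\<bar> \<le> L + 2 * D"
proof -
  let ?t = "norm (x - y)"
  have t: "0 < ?t" using assms by simp
  have D: "0 \<le> D" using assms(4)[of undefined] by linarith
  have L: "0 \<le> L" using assms(3) lipschitz_on_nonneg by blast
  have "\<bar>\<phi> y - \<phi> x\<bar> \<le> (L + 2 * D) * ?t powr \<alpha>"
  proof (cases "?t \<le> 1")
    case True
    have "\<bar>\<phi> y - \<phi> x\<bar> \<le> L * ?t"
      using lipschitz_onD[OF assms(3), of y x] by (simp add: dist_norm norm_minus_commute)
    also have "\<dots> \<le> (L + 2 * D) * ?t powr \<alpha>"
      using powr_mono'[of \<alpha> 1 ?t] True assms L D by (intro mult_mono) auto
    finally show ?thesis .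
  next
    case False
    have "\<bar>\<phi> y - \<phi> x\<bar> \<le> (L + 2 * D) * 1"
      using assms(4)[of x] assms(4)[of y] L by auto
    also have "\<dots> \<le> (L + 2 * D) * ?t powr \<alpha>"
      using False assms L D by (intro mult_left_mono ge_one_powr_ge_zero) auto
    finally show ?thesis .
  qed
  then show ?thesis using t by (simp add: field_simps)
qed

section \<open>Increments of a supersolution from a point touched by a cone and a cusp\<close>

text \<open>The viscosity inequality is transferred from test functions to \<open>u\<close> itself:
  a cusp of slope \<open>A\<close> below \<open>u\<close> keeps the infimum part above
  \<open>- A\<close>, so the supremum part is at most \<open>A + f x0\<close>. The cone supplies a
  Lipschitz test function near \<open>x0\<close>, where the cusp is too steep to be one.\<close>

lemma visc_super_increment_le:
  fixes u :: "'a::euclidean_space \<Rightarrow> real"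
  assumes \<alpha>: "0 < \<alpha>" "\<alpha> < 1" and u: "visc_super \<alpha> \<Omega> f u" and x0: "x0 \<in> \<Omega>"
    and B: "\<And>x. B \<le> u x"
    and K: "\<And>x. u x0 - K * norm (x - x0) \<le> u x"
    and A: "\<And>x. u x0 - A * norm (x - x0) powr \<alpha> \<le> u x" "0 \<le> A"
  shows "u y \<le> u x0 + (A + f x0) * norm (y - x0) powr \<alpha>"
proof (cases "y = x0")
  case False
  define d where "d = norm (y - x0) powr \<alpha>"
  have d: "0 < d" using False \<alpha> by (simp add: d_def)
  \<comment> \<open>\<open>K\<close> may have any sign, while the radius chosen below requires
    division by a positive slope.\<close>
  define k where "k = \<bar>K\<bar> + 1"
  have k: "0 < k" by (simp add: k_def)
  have k_cone: "u x0 - k * norm (x - x0) \<le> u x" for x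
  proof -
    have "K * norm (x - x0) \<le> k * norm (x - x0)"
      by (intro mult_right_mono) (auto simp: k_def)
    then show ?thesis using K[of x] by linarith
  qed
  \<comment> \<open>A Lipschitz function below a merely lower semicontinuous \<open>u\<close> need
    not reach \<open>u y\<close>, so a level \<open>c\<close> below it is used, with slack
    \<open>\<eta>\<close> in the slope. Both errors are removed at the end.\<close>
  have key: "c - u x0 \<le> (A + f x0 + \<eta>) * d" if \<eta>: "0 < \<eta>" and c: "c < u y" for \<eta> c
  proof -
    have "open {x. u x > c}" using u by (auto simp: visc_super_def lsc_def)
    then obtain e where e: "0 < e" "ball y e \<subseteq> {x. u x > c}"
      using c by (auto simp: open_contains_ball)
    \<comment> \<open>Steep enough for the cone of height \<open>c\<close> at \<open>y\<close> to
      drop to \<open>B\<close> within distance \<open>e\<close>; closer to \<open>y\<close>,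
      \<open>u\<close> exceeds \<open>c\<close>. The maximum with 0 covers
      \<open>c < B\<close>.\<close>
    define M where "M = max 0 ((c - B) / e)"
    have M: "0 \<le> M" "c - B \<le> M * e" using e by (auto simp: M_def max_def field_simps)
    have Mu: "c - M * norm (x - y) \<le> u x" for x
    proof (cases "norm (x - y) < e")
      case True
      then have "x \<in> ball y e" by (simp add: dist_norm norm_minus_commute[of y x])
      then have "c < u x" using e(2) by blast
      moreover have "0 \<le> M * norm (x - y)" using M by simp
      ultimately show ?thesis by linarith
    next
      case False
      then have "M * e \<le> M * norm (x - y)" using M by (intro mult_left_mono) auto
      then show ?thesis using M B[of x] by linarith
    qed
    \<comment> \<open>The radius at which \<open>k * t\<close> and
      \<open>\<eta> * t powr \<alpha>\<close> meet.\<close>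
    define r where "r = (\<eta> / k) powr (1 / (1 - \<alpha>))"
    have r: "0 < r" using \<eta> k by (simp add: r_def)
    have r_pow: "r powr (1 - \<alpha>) = \<eta> / k" using \<alpha> \<eta> k by (simp add: r_def powr_powr)
    have near: "k * t \<le> \<eta> * t powr \<alpha>" if "0 \<le> t" "t \<le> r" for t
    proof -
      have "t = t powr \<alpha> * t powr (1 - \<alpha>)" using that \<alpha> by (simp flip: powr_add)
      also have "\<dots> \<le> t powr \<alpha> * (\<eta> / k)"
        unfolding r_pow[symmetric] using that \<alpha> by (intro mult_left_mono powr_mono2) auto
      finally show ?thesis using k by (simp add: field_simps)
    qed
    \<comment> \<open>Since \<open>\<alpha> < 1\<close>, inside radius \<open>r\<close> the Lipschitz cone costs at most \<open>\<eta>\<close> in slope;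
      outside it the blunted cusp bounds the infimum, and the cone at \<open>y\<close> makes the supremum see \<open>u y\<close>.\<close>
    define \<phi> where "\<phi> = (\<lambda>x. max (max B (u x0 - k * norm (x - x0)))
      (max (u x0 - A * (max (norm (x - x0)) r) powr \<alpha>) (c - M * norm (x - y))))"
    have cusp: "u x0 - A * (max (norm (x - x0)) r) powr \<alpha> \<le> u x" for x
    proof -
      have "A * norm (x - x0) powr \<alpha> \<le> A * (max (norm (x - x0)) r) powr \<alpha>"
        using A \<alpha> by (intro mult_left_mono powr_mono2) auto
      then show ?thesis using A(1)[of x] by linarith
    qed
    have \<phi>_le: "\<phi> x \<le> u x" for x
      unfolding \<phi>_def using B k_cone cusp Mu by simp
    have \<phi>_x0: "\<phi> x0 = u x0"
      using \<phi>_le[of x0] by (auto simp: \<phi>_def)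
    have "\<exists>L. L-lipschitz_on UNIV \<phi>"
      unfolding \<phi>_def
      by (rule exI, rule lipschitz_on_max[OF lipschitz_on_max[OF lipschitz_on_constant lipschitz_on_cone]
            lipschitz_on_max[OF lipschitz_on_blunt_cusp lipschitz_on_cone]])
        (use k M A r \<alpha> in auto)
    then obtain L where L: "L-lipschitz_on UNIV \<phi>" by blast
    \<comment> \<open>The floor \<open>B\<close> bounds \<open>\<phi>\<close> from below; the cones
      and the cusp never exceed \<open>u x0\<close> and \<open>c\<close>.\<close>
    define D where "D = \<bar>B\<bar> + \<bar>u x0\<bar> + \<bar>c\<bar>"
    have D: "\<bar>\<phi> x\<bar> \<le> D" for x
    proof -
      have "0 \<le> k * norm (x - x0)" "0 \<le> A * (max (norm (x - x0)) r) powr \<alpha>" "0 \<le> M * norm (x - y)"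
        using k M A by auto
      then show ?thesis unfolding \<phi>_def D_def by linarith
    qed
    have "Linf \<alpha> \<phi> x0 \<le> f x0"
      using u x0 \<phi>_x0 \<phi>_le lipschitz_imp_loc_lipschitz[OF L] bounded_imp_growth_ok[of \<alpha> \<phi>, OF \<alpha>(1) D]
      by (auto simp: visc_super_def)
    moreover have "(c - u x0) / d \<le> Lplus \<alpha> \<phi> x0"
    proof -
      have "bdd_above ((\<lambda>y. (\<phi> y - \<phi> x0) / norm (x0 - y) powr \<alpha>) ` (UNIV - {x0}))"
        using abs_le_D1[OF holder_quotient_bounded[OF \<alpha> L D]]
        by (intro bdd_aboveI2[where M = "L + 2 * D"]) auto
      then have "(\<phi> y - \<phi> x0) / norm (x0 - y) powr \<alpha> \<le> Lplus \<alpha> \<phi> x0"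
        unfolding Lplus_def using False by (intro cSUP_upper) auto
      moreover have "(c - u x0) / d \<le> (\<phi> y - \<phi> x0) / norm (x0 - y) powr \<alpha>"
        unfolding d_def \<phi>_x0 by (subst norm_minus_commute) (auto simp: \<phi>_def intro!: divide_right_mono)
      ultimately show ?thesis by linarith
    qed
    moreover have "- (A + \<eta>) \<le> Lminus \<alpha> \<phi> x0"
      unfolding Lminus_def
    proof (rule cINF_greatest)
      show "UNIV - {x0} \<noteq> {}" using False by auto
    next
      fix x assume "x \<in> UNIV - {x0}"
      then have t: "0 < norm (x - x0)" by simp
      have "- (A + \<eta>) * norm (x - x0) powr \<alpha> \<le> \<phi> x - \<phi> x0"
      proof (cases "norm (x - x0) \<le> r")
        case True
        then have "k * norm (x - x0) \<le> \<eta> * norm (x - x0) powr \<alpha>" using near by simp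
        moreover have "u x0 - k * norm (x - x0) \<le> \<phi> x" by (simp add: \<phi>_def)
        moreover have "0 \<le> A * norm (x - x0) powr \<alpha>" using A by simp
        ultimately show ?thesis unfolding \<phi>_x0 by (simp add: algebra_simps)
      next
        case False
        then have "u x0 - A * norm (x - x0) powr \<alpha> \<le> \<phi> x" by (simp add: \<phi>_def max_def)
        moreover have "0 \<le> \<eta> * norm (x - x0) powr \<alpha>" using \<eta> by simp
        ultimately show ?thesis unfolding \<phi>_x0 by (simp add: algebra_simps)
      qed
      then show "- (A + \<eta>) \<le> (\<phi> x - \<phi> x0) / norm (x0 - x) powr \<alpha>"
        using t by (simp add: norm_minus_commute pos_le_divide_eq)
    qed
    ultimately have "(c - u x0) / d \<le> A + f x0 + \<eta>" by (simp add: Linf_def)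
    then show ?thesis using d by (simp add: field_simps)
  qed
  show ?thesis
  proof (rule field_le_epsilon)
    fix e :: real assume e: "0 < e"
    \<comment> \<open>The errors \<open>\<eta> * d\<close> from the slope and \<open>\<eta>\<close>
      from the level add up to \<open>e\<close>.\<close>
    define \<eta> where "\<eta> = e / (d + 1)"
    have \<eta>: "0 < \<eta>" "\<eta> * (d + 1) = e" using e d by (auto simp: \<eta>_def)
    have "(u y - \<eta>) - u x0 \<le> (A + f x0 + \<eta>) * d"
      using \<eta>(1) by (intro key) auto
    then show "u y \<le> u x0 + (A + f x0) * norm (y - x0) powr \<alpha> + e"
      unfolding d_def[symmetric] \<eta>(2)[symmetric] by (simp add: algebra_simps)
  qed
qed (use \<alpha> in auto)

section \<open>Lower semicontinuous functions: limits, sums and minima\<close>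

lemma lsc_eventually_greater:
  assumes "lsc u" "(x \<longlongrightarrow> l) F" "t < u l"
  shows "\<forall>\<^sub>F n in F. t < u (x n)"
  using topological_tendstoD[OF assms(2), of "{x. t < u x}"] assms by (simp add: lsc_def)

lemma lsc_le_limit:
  fixes u :: "'a::topological_space \<Rightarrow> real"
  assumes "lsc u" "(x \<longlongrightarrow> l) F" "(c \<longlongrightarrow> d) F" "F \<noteq> bot" "\<forall>\<^sub>F n in F. u (x n) \<le> c n"
  shows "u l \<le> d"
proof (rule ccontr)
  assume "\<not> u l \<le> d"
  then obtain t where t: "d < t" "t < u l" using dense by (meson not_le)
  have "\<forall>\<^sub>F n in F. False"
    using lsc_eventually_greater[OF assms(1,2) t(2)] order_tendstoD(2)[OF assms(3) t(1)] assms(5)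
    by eventually_elim linarith
  then show False using assms(4) by simp
qed

text \<open>Semicontinuity keeps each summand from falling in the limit, and the bound on the sum
  then keeps either from staying above. Hence values converge along minimising pairs although
  neither function is continuous.\<close>

lemma lsc_tendsto_of_sum_le:
  assumes "lsc u" "lsc w" "(x \<longlongrightarrow> l) F" "(y \<longlongrightarrow> l') F" "\<And>n. u (x n) + w (y n) \<le> u l + w l'"
  shows "((\<lambda>n. u (x n)) \<longlongrightarrow> u l) F"
proof (rule order_tendstoI)
  fix a assume "a < u l"
  then show "\<forall>\<^sub>F n in F. a < u (x n)" using lsc_eventually_greater assms by blast
next
  fix a assume "u l < a"
  then have "w l' - (a - u l) < w l'" by simp
  from lsc_eventually_greater[OF assms(2,4) this] show "\<forall>\<^sub>F n in F. u (x n) < a"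
  proof eventually_elim
    case (elim n)
    then show ?case using assms(5)[of n] by linarith
  qed
qed

lemma lsc_add:
  fixes g h :: "'a::topological_space \<Rightarrow> real"
  assumes "lsc g" "lsc h"
  shows "lsc (\<lambda>x. g x + h x)"
  unfolding lsc_def
proof
  fix t
  have "{x. g x + h x > t} = (\<Union>s. {x. g x > s} \<inter> {x. h x > t - s})"
  proof (intro equalityI subsetI)
    fix x assume "x \<in> {x. g x + h x > t}"
    then obtain s where "t - h x < s" "s < g x" using dense[of "t - h x" "g x"] by auto
    then show "x \<in> (\<Union>s. {x. g x > s} \<inter> {x. h x > t - s})" by (auto intro!: exI[of _ s])
  qed auto
  also have "open \<dots>" using assms by (auto simp: lsc_def)
  finally show "open {x. g x + h x > t}" .
qed

lemma continuous_imp_lsc: "continuous_on UNIV g \<Longrightarrow> lsc g"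
  unfolding lsc_def by (auto intro: open_Collect_less continuous_on_const)

lemma lsc_compose:
  assumes "lsc g" "continuous_on UNIV h"
  shows "lsc (\<lambda>x. g (h x))"
  unfolding lsc_def
proof
  fix t
  have "open (h -` {y. t < g y})"
    using assms by (intro open_vimage) (auto simp: lsc_def)
  then show "open {x. t < g (h x)}" by (simp add: vimage_def)
qed

lemma lsc_add_prod:
  assumes "lsc u" "lsc w"
  shows "lsc (\<lambda>z. u (fst z) + w (snd z))"
  using lsc_compose[OF assms(1) continuous_on_fst[OF continuous_on_id]]
    lsc_compose[OF assms(2) continuous_on_snd[OF continuous_on_id]] by (rule lsc_add)

text \<open>Without a minimum the open sets \<open>{x. g x > g y}\<close> would cover
  \<open>K\<close>; in a finite subcover the index with the smallest value of \<open>g\<close> is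
  left uncovered.\<close>

lemma lsc_attains_min:
  fixes g :: "'a::topological_space \<Rightarrow> real"
  assumes "lsc g" "compact K" "K \<noteq> {}"
  shows "\<exists>x\<in>K. \<forall>y\<in>K. g x \<le> g y"
proof (rule ccontr)
  assume "\<not> ?thesis"
  then have cover: "K \<subseteq> (\<Union>y\<in>K. {x. g x > g y})" by (auto simp: not_le)
  have "open {x. g x > g y}" for y using assms(1) by (auto simp: lsc_def)
  then obtain D where D: "D \<subseteq> K" "finite D" "K \<subseteq> (\<Union>y\<in>D. {x. g x > g y})"
    using compactE_image[OF assms(2) _ cover] by metis
  have "D \<noteq> {}" using D assms(3) by auto
  then have "Min (g ` D) \<in> g ` D" using D by (intro Min_in) auto
  then obtain m where m: "m \<in> D" "Min (g ` D) = g m" by blast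
  then obtain y where "y \<in> D" "g m > g y" using D by blast
  moreover have "Min (g ` D) \<le> g y" using \<open>y \<in> D\<close> D by simp
  ultimately show False using m by simp
qed

lemma lsc_bounded_below:
  fixes u :: "'a::euclidean_space \<Rightarrow> real"
  assumes "lsc u" "(u \<longlongrightarrow> C) at_infinity"
  obtains B where "\<And>x. B \<le> u x"
proof -
  have "\<forall>\<^sub>F x in at_infinity. C - 1 < u x" using assms(2) by (rule order_tendstoD) simp
  then obtain R where R: "\<And>x. R \<le> norm x \<Longrightarrow> C - 1 < u x" by (auto simp: eventually_at_infinity)
  \<comment> \<open>The absolute value keeps the ball nonempty when \<open>R\<close> is
    negative.\<close>
  obtain m where m: "\<forall>y\<in>cball 0 \<bar>R\<bar>. u m \<le> u y"
    using lsc_attains_min[OF assms(1), of "cball 0 \<bar>R\<bar>"] by auto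
  have "min (u m) (C - 1) \<le> u x" for x
  proof (cases "norm x \<le> \<bar>R\<bar>")
    case True
    then have "u m \<le> u x" using m by simp
    then show ?thesis by linarith
  next
    case False then show ?thesis using R[of x] by linarith
  qed
  then show thesis by (rule that)
qed

section \<open>Turning subsolutions into supersolutions\<close>

text \<open>A real \<open>Inf\<close> is defined as minus the \<open>Sup\<close> of the negated set,
  so negation swaps \<open>Lplus\<close> and \<open>Lminus\<close> up to sign, default values
  included.\<close>

lemma Linf_uminus: "Linf \<alpha> (\<lambda>x. - \<phi> x) x = - Linf \<alpha> \<phi> x"
proof -
  have "(- \<phi> y - - \<phi> x) / norm (x - y) powr \<alpha> = - ((\<phi> y - \<phi> x) / norm (x - y) powr \<alpha>)" for y
    by (simp add: diff_divide_distrib)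
  then show ?thesis
    by (simp add: Linf_def Lplus_def Lminus_def Inf_real_def image_image)
qed

text \<open>By oddness of \<open>Linf\<close>, the estimates for supersolutions serve both functions
  of the comparison.\<close>

lemma visc_sub_uminus:
  fixes v :: "'a::euclidean_space \<Rightarrow> real"
  assumes "visc_sub \<alpha> \<Omega> f v"
  shows "visc_super \<alpha> \<Omega> (\<lambda>x. - f x) (\<lambda>x. - v x)"
  unfolding visc_super_def
proof (intro conjI ballI allI impI)
  have "open {x. v x < - t}" for t using assms by (simp add: visc_sub_def usc_def)
  moreover have "{x. t < - v x} = {x. v x < - t}" for t by auto
  ultimately show "lsc (\<lambda>x. - v x)" by (simp add: lsc_def)
  show "growth_ok \<alpha> (\<lambda>x. - v x)" using assms by (simp add: visc_sub_def growth_ok_def)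
next
  fix x0 \<phi>
  assume x0: "x0 \<in> \<Omega>"
    and \<phi>: "loc_lipschitz \<phi> \<and> growth_ok \<alpha> \<phi> \<and> \<phi> x0 = - v x0 \<and> (\<forall>x. \<phi> x \<le> - v x)"
  have "loc_lipschitz (\<lambda>x. - \<phi> x)" "growth_ok \<alpha> (\<lambda>x. - \<phi> x)"
    using \<phi> by (auto simp: loc_lipschitz_def growth_ok_def)
  moreover have "v x \<le> - \<phi> x" for x using \<phi> by (simp add: le_minus_iff)
  ultimately have "f x0 \<le> Linf \<alpha> (\<lambda>x. - \<phi> x) x0"
    using assms x0 \<phi> by (auto simp: visc_sub_def)
  then show "Linf \<alpha> \<phi> x0 \<le> - f x0" by (simp add: Linf_uminus)
qed

section \<open>Cusp barriers and slopes towards the exterior\<close>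

text \<open>If \<open>u\<close> dipped below the cusp, \<open>u\<close> plus the cusp term would
  have its minimum at some \<open>x1\<close> in \<open>\<Omega>\<close>. There the increment
  estimate with \<open>f x1 \<le> 0\<close> bounds \<open>u x0\<close> by that minimum, which is
  smaller.\<close>

lemma visc_super_cusp_barrier:
  fixes u :: "'a::euclidean_space \<Rightarrow> real"
  assumes \<alpha>: "0 < \<alpha>" "\<alpha> < 1" and u: "visc_super \<alpha> \<Omega> f u" and \<Omega>: "bounded \<Omega>"
    and f: "\<And>x. x \<in> \<Omega> \<Longrightarrow> f x \<le> 0"
    and B: "\<And>x. B \<le> u x" and A: "0 \<le> A"
    and ext: "\<And>p. p \<notin> \<Omega> \<Longrightarrow> u x0 - A * norm (p - x0) powr \<alpha> \<le> u p"
  shows "u x0 - A * norm (x - x0) powr \<alpha> \<le> u x"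
proof (rule ccontr)
  define g where "g = (\<lambda>x. u x + A * norm (x - x0) powr \<alpha>)"
  assume "\<not> ?thesis"
  then have gx: "g x < u x0" by (simp add: g_def)
  then have x: "x \<in> \<Omega>" using ext[of x] by (force simp: g_def)
  have "lsc g"
    unfolding g_def using u \<alpha>
    by (intro lsc_add[OF _ continuous_imp_lsc] continuous_on_mult continuous_on_powr' continuous_intros) (auto simp: visc_super_def)
  then obtain x1 where x1: "\<And>z. z \<in> closure \<Omega> \<Longrightarrow> g x1 \<le> g z"
    using lsc_attains_min[of g "closure \<Omega>"] \<Omega> x by (metis closure_subset compact_closure empty_iff subsetD)
  have gx1: "g x1 < u x0" using x1[of x] gx x closure_subset by fastforce
  have x1\<Omega>: "x1 \<in> \<Omega>" using ext[of x1] gx1 by (force simp: g_def)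
  define d where "d = norm (x1 - x0)"
  \<comment> \<open>At the vertex \<open>g\<close> equals \<open>u x0\<close>, which exceeds the
    minimum, so \<open>x1\<close> is another point.\<close>
  have d: "0 < d" using gx1 \<alpha> by (auto simp: g_def d_def)
  \<comment> \<open>The minimum over the closure is global, since outside \<open>\<Omega>\<close>
    the values of \<open>g\<close> are at least \<open>u x0\<close>.\<close>
  have min: "g x1 \<le> g z" for z
    using x1[of z] ext[of z] gx1 closure_subset by (cases "z \<in> \<Omega>") (force simp: g_def)+
  have dz: "norm (z - x0) powr \<alpha> \<le> (norm (z - x1) + d) powr \<alpha>" for z
    using norm_triangle_ineq[of "z - x1" "x1 - x0"] \<alpha> by (intro powr_mono2) (auto simp: d_def)
  have uz: "u x1 - A * (norm (z - x0) powr \<alpha> - d powr \<alpha>) \<le> u z" for z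
    using min[of z] by (simp add: g_def d_def algebra_simps)
  \<comment> \<open>The cusp is Lipschitz near \<open>x1\<close> and has slope at most \<open>A\<close> from it, so the increment of \<open>u\<close>
    from \<open>x1\<close> back to the vertex \<open>x0\<close> is too small.\<close>
  have "u x0 \<le> u x1 + (A + f x1) * norm (x0 - x1) powr \<alpha>"
  proof (rule visc_super_increment_le[OF \<alpha> u x1\<Omega> B _ _ A])
    fix z
    have "norm (z - x0) powr \<alpha> - d powr \<alpha> \<le> d powr (\<alpha> - 1) * norm (z - x1)"
      using powr_diff_le[of d "norm (z - x1) + d" \<alpha>] dz[of z] d \<alpha> by simp
    from mult_left_mono[OF this A] show "u x1 - (A * d powr (\<alpha> - 1)) * norm (z - x1) \<le> u z"
      using uz[of z] by (simp add: mult.assoc)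
    have "norm (z - x0) powr \<alpha> - d powr \<alpha> \<le> norm (z - x1) powr \<alpha>"
      using powr_add_le[of "norm (z - x1)" d \<alpha>] dz[of z] d \<alpha> by simp
    from mult_left_mono[OF this A] show "u x1 - A * norm (z - x1) powr \<alpha> \<le> u z"
      using uz[of z] by simp
  qed
  also have "\<dots> \<le> u x1 + A * norm (x0 - x1) powr \<alpha>"
    using f[OF x1\<Omega>] by (intro add_left_mono mult_right_mono) auto
  also have "\<dots> = g x1" by (simp add: g_def norm_minus_commute)
  finally show False using gx1 by simp
qed

text \<open>The numerator converges and the denominator diverges. Remote points thereby force the
  slopes used later to be nonnegative.\<close>

lemma holder_quotient_tendsto_0:
  fixes u :: "'a::euclidean_space \<Rightarrow> real"
  assumes "0 < \<alpha>" "(u \<longlongrightarrow> C) at_infinity"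
  shows "((\<lambda>p. (a - u p) / norm (p - x) powr \<alpha>) \<longlongrightarrow> 0) at_infinity"
proof -
  have "filterlim (\<lambda>p. - norm x + norm p) at_top at_infinity"
    by (intro filterlim_tendsto_add_at_top[OF tendsto_const] filterlim_norm_at_top)
  then have "filterlim (\<lambda>p. norm (p - x)) at_top at_infinity"
    by (rule filterlim_at_top_mono) (auto intro!: always_eventually simp: norm_triangle_ineq2)
  then have "((\<lambda>p. norm (p - x) powr (- \<alpha>)) \<longlongrightarrow> 0) at_infinity"
    using assms(1) by (intro tendsto_neg_powr) auto
  then have "((\<lambda>p. (a - u p) * norm (p - x) powr (- \<alpha>)) \<longlongrightarrow> (a - C) * 0) at_infinity"
    using assms(2) by (intro tendsto_intros)
  then show ?thesis by (simp add: powr_minus_divide)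
qed

lemma eventually_notin_bounded:
  assumes "bounded S"
  shows "\<forall>\<^sub>F p in at_infinity. p \<notin> S"
proof -
  obtain R where "\<And>p. p \<in> S \<Longrightarrow> norm p \<le> R" using assms by (auto simp: bounded_iff)
  then show ?thesis by (force simp: eventually_at_infinity intro!: exI[of _ "R + 1"])
qed

text \<open>\<open>A\<close> is the supremum over exterior points of the downward slope of
  \<open>u\<close> from \<open>x\<close>: finite because these points are at distance at least
  \<open>\<rho>\<close> and \<open>u\<close> is bounded below, nonnegative because slopes vanish at
  infinity, and nearly attained as any supremum.\<close>

lemma exterior_slope:
  fixes u :: "'a::euclidean_space \<Rightarrow> real"
  assumes \<alpha>: "0 < \<alpha>" and B: "\<And>x. B \<le> u x" and u: "(u \<longlongrightarrow> C) at_infinity" and \<Omega>: "bounded \<Omega>"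
    and \<rho>: "0 < \<rho>" "ball x \<rho> \<subseteq> \<Omega>"
  obtains A where "0 \<le> A" "A \<le> (u x - B) / \<rho> powr \<alpha>"
    "\<And>p. p \<notin> \<Omega> \<Longrightarrow> u x - A * norm (p - x) powr \<alpha> \<le> u p"
    "\<And>\<epsilon>. 0 < \<epsilon> \<Longrightarrow> \<exists>p. p \<notin> \<Omega> \<and> u p \<le> u x - (A - \<epsilon>) * norm (p - x) powr \<alpha>"
proof -
  define q where "q = (\<lambda>p. (u x - u p) / norm (p - x) powr \<alpha>)"
  define A where "A = (SUP p\<in>- \<Omega>. q p)"
  have far: "\<rho> \<le> norm (p - x)" if "p \<notin> \<Omega>" for p
    using that \<rho> by (force simp: dist_norm norm_minus_commute[of x p])
  have q_le: "q p \<le> (u x - B) / \<rho> powr \<alpha>" if "p \<notin> \<Omega>" for p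
    unfolding q_def using B[of x] B[of p] \<alpha> \<rho> far[OF that]
    by (intro frac_le powr_mono2) auto
  have evt: "\<forall>\<^sub>F p in at_infinity. p \<notin> \<Omega>" using \<Omega> by (rule eventually_notin_bounded)
  then have ne: "- \<Omega> \<noteq> {}" using eventually_happens'[OF trivial_limit_at_infinity evt] by auto
  have bdd: "bdd_above (q ` (- \<Omega>))" using q_le by (intro bdd_aboveI2) auto
  have q_A: "q p \<le> A" if "p \<notin> \<Omega>" for p
    unfolding A_def using bdd that by (intro cSUP_upper) auto
  have pos: "0 < norm (p - x) powr \<alpha>" if "p \<notin> \<Omega>" for p using far[OF that] \<rho> by auto
  show thesis
  proof (rule that)
    show "A \<le> (u x - B) / \<rho> powr \<alpha>"
      unfolding A_def using ne q_le by (intro cSUP_least) auto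
    show "0 \<le> A"
    proof (rule tendsto_upperbound)
      show "(q \<longlongrightarrow> 0) at_infinity" unfolding q_def using \<alpha> u by (rule holder_quotient_tendsto_0)
      show "\<forall>\<^sub>F p in at_infinity. q p \<le> A" using evt by eventually_elim (rule q_A)
    qed (rule trivial_limit_at_infinity)
    show "u x - A * norm (p - x) powr \<alpha> \<le> u p" if "p \<notin> \<Omega>" for p
      using q_A[OF that] pos[OF that] by (simp add: q_def pos_divide_le_eq)
    show "\<exists>p. p \<notin> \<Omega> \<and> u p \<le> u x - (A - \<epsilon>) * norm (p - x) powr \<alpha>" if \<epsilon>: "0 < \<epsilon>" for \<epsilon>
    proof -
      have "A - \<epsilon> < A" using \<epsilon> by simp
      then obtain p where p: "p \<notin> \<Omega>" "A - \<epsilon> < q p"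
        unfolding A_def using less_cSUP_iff[OF ne bdd] by auto
      then have "(A - \<epsilon>) * norm (p - x) powr \<alpha> < u x - u p"
        using pos[OF p(1)] by (simp add: q_def pos_less_divide_eq)
      then show ?thesis using p(1) by (intro exI[of _ p]) simp
    qed
  qed
qed

section \<open>Doubling of variables and passage to the limit\<close>

text \<open>The pair \<open>(p, p)\<close> has a negative value free of penalty. If both points are
  remote the sum is nearly \<open>C + C'\<close>, and if only one is, the penalty outweighs the
  lower bounds; so competitors stay in a ball that is independent of \<open>k\<close>.\<close>

lemma doubled_penalised_sum_attains_min:
  fixes u w :: "'a::euclidean_space \<Rightarrow> real"
  assumes u: "lsc u" "(u \<longlongrightarrow> C) at_infinity" and w: "lsc w" "(w \<longlongrightarrow> C') at_infinity"
    and C: "0 \<le> C + C'" and p: "u p + w p < 0"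
  obtains R where "\<And>k. 1 \<le> k \<Longrightarrow> \<exists>x\<in>cball 0 R. \<exists>y\<in>cball 0 R. \<forall>x' y'.
    u x + w y + k * norm (x - y) \<le> u x' + w y' + k * norm (x' - y')"
proof -
  define t where "t = u p + w p"
  have t: "t < 0" using p by (simp add: t_def)
  obtain B where B: "\<And>x. B \<le> u x" using lsc_bounded_below[OF u] by blast
  obtain B' where B': "\<And>x. B' \<le> w x" using lsc_bounded_below[OF w] by blast
  \<comment> \<open>A loss of a quarter of \<open>\<bar>t\<bar>\<close> in each function leaves the
    sum of remote values above \<open>t / 2\<close>, hence above \<open>t\<close>.\<close>
  have "C + t / 4 < C" "C' + t / 4 < C'" using t by auto
  then have "\<forall>\<^sub>F x in at_infinity. C + t / 4 < u x \<and> C' + t / 4 < w x"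
    by (intro eventually_conj order_tendstoD(1)[OF u(2)] order_tendstoD(1)[OF w(2)])
  then obtain R where R: "\<And>x. R \<le> norm x \<Longrightarrow> C + t / 4 < u x \<and> C' + t / 4 < w x"
    by (auto simp: eventually_at_infinity)
  \<comment> \<open>If one point is beyond \<open>S\<close> and the other within \<open>R\<close>,
    their distance is at least \<open>\<bar>B + B'\<bar>\<close>, so the penalised sum is
    nonnegative.\<close>
  define S where "S = R + \<bar>B + B'\<bar> + norm p"
  have out: "t < u x + w y + k * norm (x - y)" if "1 \<le> k" "S < norm x \<or> S < norm y" for x y k
  proof -
    have kxy: "norm (x - y) \<le> k * norm (x - y)"
      using mult_right_mono[OF that(1), of "norm (x - y)"] by simp
    show ?thesis
    proof (cases "R \<le> norm x \<and> R \<le> norm y")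
      case True
      then show ?thesis using R[of x] R[of y] C t kxy norm_ge_zero[of "x - y"] by linarith
    next
      case False
      then have "\<bar>B + B'\<bar> \<le> norm (x - y)"
        using that(2) norm_triangle_ineq3[of x y] norm_ge_zero[of p] unfolding S_def by linarith
      then show ?thesis using B[of x] B'[of y] t kxy by linarith
    qed
  qed
  have "\<exists>x\<in>cball 0 S. \<exists>y\<in>cball 0 S. \<forall>x' y'.
    u x + w y + k * norm (x - y) \<le> u x' + w y' + k * norm (x' - y')" if k: "1 \<le> k" for k
  proof -
    define \<Phi> where "\<Phi> = (\<lambda>z. u (fst z) + w (snd z) + k * norm (fst z - snd z))"
    have "lsc \<Phi>"
      unfolding \<Phi>_def using u w
      by (intro lsc_add[OF lsc_add_prod continuous_imp_lsc] continuous_intros) auto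
    have \<Phi>p: "\<Phi> (p, p) = t" by (simp add: \<Phi>_def t_def)
    \<comment> \<open>Otherwise \<open>out\<close> would give \<open>t < t\<close>.\<close>
    have pS: "(p, p) \<in> cball 0 S \<times> cball 0 S"
      using out[OF k, of p p] by (force simp: t_def)
    obtain z where z: "z \<in> cball 0 S \<times> cball 0 S" "\<And>z'. z' \<in> cball 0 S \<times> cball 0 S \<Longrightarrow> \<Phi> z \<le> \<Phi> z'"
      using lsc_attains_min[OF \<open>lsc \<Phi>\<close>, of "cball 0 S \<times> cball 0 S"] pS
      by (metis compact_Times compact_cball empty_iff)
    have "\<Phi> z \<le> \<Phi> (x', y')" for x' y'
    proof (cases "(x', y') \<in> cball 0 S \<times> cball 0 S")
      case False
      then have "t < \<Phi> (x', y')" using out[OF k, of x' y'] by (auto simp: \<Phi>_def not_le)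
      then show ?thesis using z(2)[OF pS] \<Phi>p by linarith
    qed (use z in blast)
    then have "\<forall>x' y'. u (fst z) + w (snd z) + k * norm (fst z - snd z) \<le> u x' + w y' + k * norm (x' - y')"
      by (simp add: \<Phi>_def)
    moreover have "fst z \<in> cball 0 S" "snd z \<in> cball 0 S" using z(1) by (auto simp: mem_Times_iff)
    ultimately show ?thesis by blast
  qed
  then show thesis by (rule that)
qed

text \<open>Moving to a nearly extremal exterior point lowers \<open>u\<close> by almost the amount
  by which \<open>w\<close> can rise, so the sum does not grow in the limit. These points stay
  bounded if the limit slope \<open>A'\<close> is positive; if it is zero, any exterior point
  serves.\<close>

lemma limiting_exterior_point:
  fixes u w :: "'a::euclidean_space \<Rightarrow> real"
  assumes u: "lsc u" "\<And>x. B \<le> u x" and w: "lsc w" and \<Omega>: "open \<Omega>" "q0 \<notin> \<Omega>" and \<alpha>: "0 < \<alpha>"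
    and x: "x \<longlonglongrightarrow> x0" "(\<lambda>n. u (x n)) \<longlonglongrightarrow> a" and y: "y \<longlonglongrightarrow> x0" "(\<lambda>n. w (y n)) \<longlonglongrightarrow> b"
    and A: "A \<longlonglongrightarrow> A'" and \<delta>: "\<delta> \<longlonglongrightarrow> 0" and A': "0 \<le> A'"
    and u_le: "\<And>n z. u z \<le> u (x n) + A n * norm (z - x n) powr \<alpha>"
    and w_le: "\<And>n z. w z \<le> w (y n) + (A n + \<delta> n) * norm (z - y n) powr \<alpha>"
    and near: "\<And>n \<epsilon>. 0 < \<epsilon> \<Longrightarrow> \<exists>p. p \<notin> \<Omega> \<and> u p \<le> u (x n) - (A n - \<epsilon>) * norm (p - x n) powr \<alpha>"
  shows "\<exists>q. q \<notin> \<Omega> \<and> u q + w q \<le> a + b"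
proof (cases "A' = 0")
  case True
  \<comment> \<open>With limit slope zero both upper bounds on the increments vanish, even at the
    fixed point \<open>q0\<close>.\<close>
  have "(\<lambda>n. u (x n) + A n * norm (q0 - x n) powr \<alpha>) \<longlonglongrightarrow> a + A' * norm (q0 - x0) powr \<alpha>"
    by (intro tendsto_intros x A tendsto_powr') (use \<alpha> in auto)
  then have "u q0 \<le> a" using True u_le by (intro LIMSEQ_le_const) auto
  have "(\<lambda>n. w (y n) + (A n + \<delta> n) * norm (q0 - y n) powr \<alpha>) \<longlonglongrightarrow> b + (A' + 0) * norm (q0 - x0) powr \<alpha>"
    by (intro tendsto_intros y A \<delta> tendsto_powr') (use \<alpha> in auto)
  then have "w q0 \<le> b" using True w_le by (intro LIMSEQ_le_const) auto
  with \<open>u q0 \<le> a\<close> \<Omega> show ?thesis by (intro exI[of _ q0]) auto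
next
  case False
  define \<epsilon> where "\<epsilon> = (\<lambda>n. inverse (real (Suc n)))"
  have \<epsilon>: "\<epsilon> \<longlonglongrightarrow> 0" "\<And>n. 0 < \<epsilon> n" unfolding \<epsilon>_def using LIMSEQ_inverse_real_of_nat by auto
  have "\<exists>p. p \<notin> \<Omega> \<and> u p \<le> u (x n) - (A n - \<epsilon> n) * norm (p - x n) powr \<alpha>" for n
    using near \<epsilon>(2) by blast
  then obtain p where p: "\<And>n. p n \<notin> \<Omega>" "\<And>n. u (p n) \<le> u (x n) - (A n - \<epsilon> n) * norm (p n - x n) powr \<alpha>"
    by metis
  \<comment> \<open>A positive lower bound for the slopes turns \<open>B \<le> u (p n)\<close> into
    a bound on the distance from \<open>x n\<close> to \<open>p n\<close>.\<close>
  define c where "c = A' / 2"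
  have c: "0 < c" "c < A'" using False A' by (auto simp: c_def)
  have "(\<lambda>n. A n - \<epsilon> n) \<longlonglongrightarrow> A' - 0" by (intro tendsto_intros A \<epsilon>)
  then have "\<forall>\<^sub>F n in sequentially. c < A n - \<epsilon> n" using c by (intro order_tendstoD(1)) auto
  moreover have "\<forall>\<^sub>F n in sequentially. u (x n) < a + 1" using x(2) by (rule order_tendstoD(2)) simp
  moreover have "\<forall>\<^sub>F n in sequentially. norm (x n) < norm x0 + 1"
    using tendsto_norm[OF x(1)] by (rule order_tendstoD(2)) simp
  ultimately have "\<forall>\<^sub>F n in sequentially. norm (p n) \<le> norm x0 + 1 + ((a + 1 - B) / c) powr (1 / \<alpha>)"
  proof eventually_elim
    case (elim n)
    have "c * norm (p n - x n) powr \<alpha> \<le> (A n - \<epsilon> n) * norm (p n - x n) powr \<alpha>"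
      using elim by (intro mult_right_mono) auto
    then have "c * norm (p n - x n) powr \<alpha> \<le> a + 1 - B" using elim p(2)[of n] u(2)[of "p n"] by linarith
    then have "norm (p n - x n) powr \<alpha> \<le> (a + 1 - B) / c" using c by (simp add: field_simps)
    then have "(norm (p n - x n) powr \<alpha>) powr (1 / \<alpha>) \<le> ((a + 1 - B) / c) powr (1 / \<alpha>)"
      using \<alpha> by (intro powr_mono2) auto
    then have "norm (p n - x n) \<le> ((a + 1 - B) / c) powr (1 / \<alpha>)" using \<alpha> by (simp add: powr_powr)
    then show ?case using elim norm_triangle_ineq2[of "p n" "x n"] by linarith
  qed
  then obtain N where N: "\<And>n. N \<le> n \<Longrightarrow> p n \<in> cball 0 (norm x0 + 1 + ((a + 1 - B) / c) powr (1 / \<alpha>))"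
    by (auto simp: eventually_sequentially)
  obtain q s where q: "strict_mono s" "((\<lambda>n. p (n + N)) \<circ> s) \<longlonglongrightarrow> q"
    using seq_compactE[OF compact_imp_seq_compact[OF compact_cball], of "\<lambda>n. p (n + N)"] N[OF le_add2]
    by blast
  define \<sigma> where "\<sigma> = (\<lambda>n. s n + N)"
  have \<sigma>: "strict_mono \<sigma>" using q(1) by (simp add: \<sigma>_def strict_mono_def)
  have p\<sigma>: "(\<lambda>n. p (\<sigma> n)) \<longlonglongrightarrow> q" using q(2) by (simp add: \<sigma>_def o_def)
  have "closed (- \<Omega>)" using \<Omega> by auto
  then have "q \<in> - \<Omega>" by (rule closed_sequentially[OF _ _ p\<sigma>]) (simp add: p)
  note lim = LIMSEQ_subseq_LIMSEQ[OF _ \<sigma>, unfolded o_def]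
  have "u q \<le> a - (A' - 0) * norm (q - x0) powr \<alpha>"
  proof (rule lsc_le_limit[OF u(1) p\<sigma>])
    show "(\<lambda>n. u (x (\<sigma> n)) - (A (\<sigma> n) - \<epsilon> (\<sigma> n)) * norm (p (\<sigma> n) - x (\<sigma> n)) powr \<alpha>)
        \<longlonglongrightarrow> a - (A' - 0) * norm (q - x0) powr \<alpha>"
      by (intro tendsto_intros p\<sigma> lim[OF x(1)] lim[OF x(2)] lim[OF A] lim[OF \<epsilon>(1)] tendsto_powr')
        (use \<alpha> in auto)
  qed (use p in auto)
  moreover have "w q \<le> b + (A' + 0) * norm (q - x0) powr \<alpha>"
  proof (rule lsc_le_limit[OF w])
    \<comment> \<open>\<open>w\<close> is evaluated at the translate of \<open>p\<close>, so that
      its increment from \<open>y\<close> has the same length as that of \<open>u\<close> from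
      \<open>x\<close>; the translate also tends to \<open>q\<close> because \<open>x\<close> and
      \<open>y\<close> share their limit.\<close>
    show "(\<lambda>n. y (\<sigma> n) + (p (\<sigma> n) - x (\<sigma> n))) \<longlonglongrightarrow> q"
      using tendsto_add[OF lim[OF y(1)] tendsto_diff[OF p\<sigma> lim[OF x(1)]]] by simp
    show "(\<lambda>n. w (y (\<sigma> n)) + (A (\<sigma> n) + \<delta> (\<sigma> n)) * norm (p (\<sigma> n) - x (\<sigma> n)) powr \<alpha>)
        \<longlonglongrightarrow> b + (A' + 0) * norm (q - x0) powr \<alpha>"
      by (intro tendsto_intros p\<sigma> lim[OF x(1)] lim[OF y(2)] lim[OF A] lim[OF \<delta>] tendsto_powr')
        (use \<alpha> in auto)
    show "\<forall>\<^sub>F n in sequentially. w (y (\<sigma> n) + (p (\<sigma> n) - x (\<sigma> n)))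
        \<le> w (y (\<sigma> n)) + (A (\<sigma> n) + \<delta> (\<sigma> n)) * norm (p (\<sigma> n) - x (\<sigma> n)) powr \<alpha>"
      using w_le[of "y (\<sigma> n) + (p (\<sigma> n) - x (\<sigma> n))" "\<sigma> n" for n] by (auto intro!: always_eventually)
  qed simp
  ultimately show ?thesis using \<open>q \<in> - \<Omega>\<close> by (intro exI[of _ q]) auto
qed

text \<open>Varying one variable alone gives a cone of slope \<open>k\<close> below each function.
  Shifting both by the same vector leaves the penalty unchanged, so the upper bound on increments of
  \<open>u\<close> becomes a cusp below \<open>w\<close>, and the increment estimate applies a
  second time.\<close>

lemma increments_at_doubled_min:
  fixes u w :: "'a::euclidean_space \<Rightarrow> real"
  assumes \<alpha>: "0 < \<alpha>" "\<alpha> < 1"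
    and u: "visc_super \<alpha> \<Omega> f u" "\<And>z. B \<le> u z" "(u \<longlongrightarrow> C) at_infinity"
    and w: "visc_super \<alpha> \<Omega> g w" "\<And>z. B' \<le> w z"
    and xy: "x \<in> \<Omega>" "y \<in> \<Omega>"
    and min: "\<And>x' y'. u x + w y + k * norm (x - y) \<le> u x' + w y' + k * norm (x' - y')"
    and k: "0 \<le> k"
    and A: "0 \<le> A" "\<And>z. u x - A * norm (z - x) powr \<alpha> \<le> u z"
  shows "u z \<le> u x + (A + f x) * norm (z - x) powr \<alpha>"
    and "w z \<le> w y + (A + f x + g y) * norm (z - y) powr \<alpha>"
proof -
  have tri: "k * norm (x' - y') \<le> k * norm (x - y) + k * h" if "norm (x' - y') \<le> norm (x - y) + h" for x' y' :: 'a and h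
    using mult_left_mono[OF that k] by (simp add: distrib_left)
  have u_le: "u z \<le> u x + (A + f x) * norm (z - x) powr \<alpha>" for z
  proof (rule visc_super_increment_le[OF \<alpha> u(1) xy(1) u(2) _ A(2,1)])
    show "u x - k * norm (z - x) \<le> u z" for z
      using min[of z y] tri[of z y "norm (z - x)"] norm_triangle_ineq[of "z - x" "x - y"] by simp
  qed
  then show "u z \<le> u x + (A + f x) * norm (z - x) powr \<alpha>" .
  \<comment> \<open>This is to be the slope of the cusp below \<open>w\<close>; letting
    \<open>z\<close> tend to infinity in \<open>u_le\<close> shows its sign.\<close>
  have slope: "0 \<le> A + f x"
  proof (rule tendsto_upperbound)
    show "((\<lambda>z. - ((u x - u z) / norm (z - x) powr \<alpha>)) \<longlongrightarrow> 0) at_infinity"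
      using tendsto_minus[OF holder_quotient_tendsto_0[OF \<alpha>(1) u(3)]] by simp
    have "\<forall>\<^sub>F z in at_infinity. norm x + 1 \<le> norm z" by (auto simp: eventually_at_infinity)
    then show "\<forall>\<^sub>F z in at_infinity. - ((u x - u z) / norm (z - x) powr \<alpha>) \<le> A + f x"
    proof eventually_elim
      case (elim z)
      then have "0 < norm (z - x) powr \<alpha>" by auto
      then show ?case using u_le[of z] by (simp add: field_simps)
    qed
  qed (rule trivial_limit_at_infinity)
  have "w z \<le> w y + ((A + f x) + g y) * norm (z - y) powr \<alpha>" for z
  proof (rule visc_super_increment_le[OF \<alpha> w(1) xy(2) w(2) _ _ slope])
    show "w y - k * norm (z - y) \<le> w z" for z
      using min[of x z] tri[of x z "norm (z - y)"] norm_triangle_ineq[of "x - y" "y - z"]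
      by (simp add: norm_minus_commute[of z y])
    \<comment> \<open>The pair is shifted by \<open>z - y\<close>.\<close>
    show "w y - (A + f x) * norm (z - y) powr \<alpha> \<le> w z" for z
      using min[of "x + (z - y)" z] u_le[of "x + (z - y)"] by simp
  qed
  then show "w z \<le> w y + (A + f x + g y) * norm (z - y) powr \<alpha>" .
qed

section \<open>Comparison of a supersolution with a subsolution\<close>

theorem mainTheorem4:
  fixes \<Omega> :: "'a::euclidean_space set"
    and f u v :: "'a \<Rightarrow> real" and \<alpha> C1 C2 :: real
  assumes "0 < \<alpha>" "\<alpha> < 1"
    and "open \<Omega>" "connected \<Omega>" "\<Omega> \<noteq> {}" "bounded \<Omega>"
    and "continuous_on \<Omega> f" "bounded (f ` \<Omega>)" "\<forall>x\<in>\<Omega>. f x \<le> 0"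
    and "visc_super \<alpha> \<Omega> f u" "visc_sub \<alpha> \<Omega> f v"
    and "bounded (u ` (UNIV - \<Omega>))"
    and "\<forall>x\<in>UNIV - \<Omega>. u x \<ge> v x"
    and "(u \<longlongrightarrow> C1) at_infinity" "(v \<longlongrightarrow> C2) at_infinity"
  shows "\<forall>x\<in>\<Omega>. u x \<ge> v x"
proof (rule ccontr)
  assume "\<not> ?thesis"
  then obtain p where p: "u p < v p" by (auto simp: not_le)
  note \<alpha> = assms(1,2) and \<Omega> = assms(3,6) and u_lim = assms(14)
  define w where "w = (\<lambda>x. - v x)"
  define t where "t = u p + w p"
  have t: "t < 0" using p by (simp add: t_def w_def)
  have u: "visc_super \<alpha> \<Omega> f u" and w: "visc_super \<alpha> \<Omega> (\<lambda>x. - f x) w"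
    unfolding w_def using assms(10,11) visc_sub_uminus by auto
  then have lsc: "lsc u" "lsc w" by (auto simp: visc_super_def)
  have w_lim: "(w \<longlongrightarrow> - C2) at_infinity" unfolding w_def using assms(15) by (rule tendsto_minus)
  obtain B where B: "\<And>z. B \<le> u z" using lsc_bounded_below[OF lsc(1) u_lim] by blast
  obtain B' where B': "\<And>z. B' \<le> w z" using lsc_bounded_below[OF lsc(2) w_lim] by blast
  have ext: "0 \<le> u z + w z" if "z \<notin> \<Omega>" for z using assms(13) that by (auto simp: w_def)
  have evt: "\<forall>\<^sub>F z in at_infinity. z \<notin> \<Omega>" using \<Omega>(2) by (rule eventually_notin_bounded)
  \<comment> \<open>The exterior ordering passes to infinity, so a negative minimum cannot escape
    there.\<close>
  have C: "0 \<le> C1 + - C2"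
  proof (rule tendsto_lowerbound)
    show "((\<lambda>z. u z + w z) \<longlongrightarrow> C1 + - C2) at_infinity" using u_lim w_lim by (rule tendsto_add)
    show "\<forall>\<^sub>F z in at_infinity. 0 \<le> u z + w z" using evt by eventually_elim (rule ext)
  qed (rule trivial_limit_at_infinity)
  obtain q0 where q0: "q0 \<notin> \<Omega>" using eventually_happens'[OF trivial_limit_at_infinity evt] by auto
  obtain R where R: "\<And>k. 1 \<le> k \<Longrightarrow> \<exists>x\<in>cball 0 R. \<exists>y\<in>cball 0 R. \<forall>x' y'.
      u x + w y + k * norm (x - y) \<le> u x' + w y' + k * norm (x' - y')"
    using doubled_penalised_sum_attains_min[OF lsc(1) u_lim lsc(2) w_lim C] t t_def by blast
  have "\<exists>x y. x \<in> cball 0 R \<and> (\<forall>x' y'. u x + w y + real (Suc n) * norm (x - y)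
      \<le> u x' + w y' + real (Suc n) * norm (x' - y'))" for n
  proof -
    have "1 \<le> real (Suc n)" by simp
    from R[OF this] show ?thesis by blast
  qed
  then obtain X Y where X: "\<And>n. X n \<in> cball 0 R"
    and min: "\<And>n x' y'. u (X n) + w (Y n) + real (Suc n) * norm (X n - Y n)
      \<le> u x' + w y' + real (Suc n) * norm (x' - y')"
    by metis
  \<comment> \<open>On diagonal pairs the penalty vanishes.\<close>
  have diag: "u (X n) + w (Y n) \<le> u z + w z" for n z
  proof -
    have "0 \<le> real (Suc n) * norm (X n - Y n)" by simp
    then show ?thesis using min[of n z z] unfolding diff_self norm_zero by linarith
  qed
  \<comment> \<open>The penalised minimum is at most \<open>t\<close> and the functions are bounded
    below, so the distance is of order 1 over the penalty factor.\<close>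
  have XY: "(\<lambda>n. X n - Y n) \<longlonglongrightarrow> 0"
  proof (rule Lim_null_comparison)
    show "\<forall>\<^sub>F n in sequentially. norm (X n - Y n) \<le> (t - B - B') * inverse (real (Suc n))"
    proof (intro always_eventually allI)
      fix n
      have "real (Suc n) * norm (X n - Y n) \<le> t - B - B'"
        using min[of n p p] B[of "X n"] B'[of "Y n"] unfolding diff_self norm_zero t_def by linarith
      then show "norm (X n - Y n) \<le> (t - B - B') * inverse (real (Suc n))"
        by (simp add: field_simps)
    qed
    show "(\<lambda>n. (t - B - B') * inverse (real (Suc n))) \<longlonglongrightarrow> 0"
      using tendsto_mult_right_zero[OF LIMSEQ_inverse_real_of_nat] .
  qed
  obtain x0 r where r: "strict_mono r" "(X \<circ> r) \<longlonglongrightarrow> x0"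
    using seq_compactE[OF compact_imp_seq_compact[OF compact_cball[of 0 R]]] X by blast
  have Xr: "(\<lambda>n. X (r n)) \<longlonglongrightarrow> x0" using r(2) by (simp add: o_def)
  have Yr: "(\<lambda>n. Y (r n)) \<longlonglongrightarrow> x0"
    using tendsto_diff[OF Xr LIMSEQ_subseq_LIMSEQ[OF XY r(1), unfolded o_def]] by simp
  have "lsc (\<lambda>z. u (fst z) + w (snd z))"
    using lsc by (rule lsc_add_prod)
  from lsc_le_limit[OF this tendsto_Pair[OF Xr Yr] tendsto_const[of t]]
  have x0: "u x0 + w x0 \<le> t" using diag[of _ p] by (simp add: t_def)
  then have "x0 \<in> \<Omega>" using ext[of x0] t by force
  then obtain \<rho>' where \<rho>': "0 < \<rho>'" "ball x0 \<rho>' \<subseteq> \<Omega>" using \<Omega>(1) by (auto simp: open_contains_ball)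
  \<comment> \<open>Halving lets balls about all points near \<open>x0\<close> share one radius,
    which yields the common bound \<open>M\<close> on their exterior slopes.\<close>
  define \<rho> where "\<rho> = \<rho>' / 2"
  have \<rho>: "0 < \<rho>" "ball z \<rho> \<subseteq> \<Omega>" "z \<in> \<Omega>" if "dist z x0 < \<rho>" for z
  proof -
    show "0 < \<rho>" using \<rho>' by (simp add: \<rho>_def)
    have "ball z \<rho> \<subseteq> ball x0 \<rho>'"
    proof
      fix z' assume "z' \<in> ball z \<rho>"
      then show "z' \<in> ball x0 \<rho>'"
        using that dist_triangle[of x0 z' z] by (simp add: \<rho>_def dist_commute)
    qed
    then show "ball z \<rho> \<subseteq> \<Omega>" using \<rho>'(2) by blast
    then show "z \<in> \<Omega>" using \<open>0 < \<rho>\<close> centre_in_ball by blast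
  qed
  \<comment> \<open>\<open>diag\<close> at \<open>x0\<close> supplies the upper bound on the
    sum.\<close>
  have uX: "(\<lambda>n. u (X (r n))) \<longlonglongrightarrow> u x0"
    using lsc_tendsto_of_sum_le[OF lsc Xr Yr] diag by blast
  have wY: "(\<lambda>n. w (Y (r n))) \<longlonglongrightarrow> w x0"
    using lsc_tendsto_of_sum_le[OF lsc(2,1) Yr Xr] diag by (simp add: add.commute)
  have "\<forall>\<^sub>F n in sequentially. dist (X (r n)) x0 < \<rho> \<and> dist (Y (r n)) x0 < \<rho> \<and> u (X (r n)) < u x0 + 1"
    using \<rho>' by (intro eventually_conj tendstoD[OF Xr] tendstoD[OF Yr] order_tendstoD(2)[OF uX])
      (auto simp: \<rho>_def)
  then obtain N where N: "\<And>n. N \<le> n \<Longrightarrow>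
      dist (X (r n)) x0 < \<rho> \<and> dist (Y (r n)) x0 < \<rho> \<and> u (X (r n)) < u x0 + 1"
    by (auto simp: eventually_sequentially)
  define M where "M = (u x0 + 1 - B) / \<rho> powr \<alpha>"
  define x where "x = (\<lambda>n. X (r (n + N)))"
  define y where "y = (\<lambda>n. Y (r (n + N)))"
  define k where "k = (\<lambda>n. real (Suc (r (n + N))))"
  have x: "dist (x n) x0 < \<rho>" "u (x n) < u x0 + 1" and y: "dist (y n) x0 < \<rho>" for n
    using N[of "n + N"] by (auto simp: x_def y_def)
  note in\<Omega> = \<rho>(3)[OF x(1)] \<rho>(3)[OF y]
  have "\<exists>A. A \<in> {0..M} \<and> (\<forall>q. q \<notin> \<Omega> \<longrightarrow> u (x n) - A * norm (q - x n) powr \<alpha> \<le> u q) \<and>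
    (\<forall>\<epsilon>>0. \<exists>q. q \<notin> \<Omega> \<and> u q \<le> u (x n) - (A - \<epsilon>) * norm (q - x n) powr \<alpha>)" for n
  proof -
    have "(u (x n) - B) / \<rho> powr \<alpha> \<le> M"
      unfolding M_def using x(2)[of n] by (intro divide_right_mono) auto
    moreover obtain A where "0 \<le> A" "A \<le> (u (x n) - B) / \<rho> powr \<alpha>"
      "\<And>q. q \<notin> \<Omega> \<Longrightarrow> u (x n) - A * norm (q - x n) powr \<alpha> \<le> u q"
      "\<And>\<epsilon>. 0 < \<epsilon> \<Longrightarrow> \<exists>q. q \<notin> \<Omega> \<and> u q \<le> u (x n) - (A - \<epsilon>) * norm (q - x n) powr \<alpha>"
      using exterior_slope[OF \<alpha>(1) B u_lim \<Omega>(2) \<rho>(1,2)[OF x(1)[of n]]] by metis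
    ultimately show ?thesis by (intro exI[of _ A]) simp
  qed
  then obtain A where A: "\<And>n. A n \<in> {0..M}"
    and A_ext: "\<And>n q. q \<notin> \<Omega> \<Longrightarrow> u (x n) - A n * norm (q - x n) powr \<alpha> \<le> u q"
    and A_near: "\<And>n \<epsilon>. 0 < \<epsilon> \<Longrightarrow> \<exists>q. q \<notin> \<Omega> \<and> u q \<le> u (x n) - (A n - \<epsilon>) * norm (q - x n) powr \<alpha>"
    by metis
  obtain A' s where A': "A' \<in> {0..M}" and s: "strict_mono s" "(A \<circ> s) \<longlonglongrightarrow> A'"
    using seq_compactE[OF compact_imp_seq_compact[OF compact_Icc[of 0 M]]] A by blast
  \<comment> \<open>Indices pass through the subsequence \<open>s\<close>, the shift by
    \<open>N\<close>, and the subsequence \<open>r\<close>.\<close>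
  have shift: "(\<lambda>n. g (r (s n + N))) \<longlonglongrightarrow> l" if "(\<lambda>n. g (r n)) \<longlonglongrightarrow> l"
    for g :: "nat \<Rightarrow> 'b::topological_space" and l
    using LIMSEQ_subseq_LIMSEQ[OF LIMSEQ_ignore_initial_segment[OF that, of N] s(1)] by (simp add: o_def)
  have A_nonneg: "0 \<le> A n" for n using A[of n] by simp
  \<comment> \<open>A slope tested only outside \<open>\<Omega>\<close> holds everywhere, as the
    increment estimates require.\<close>
  have barrier: "u (x n) - A n * norm (z - x n) powr \<alpha> \<le> u z" for n z
    using visc_super_cusp_barrier[OF \<alpha> u \<Omega>(2) _ B A_nonneg A_ext] assms(9) by blast
  have "\<exists>q. q \<notin> \<Omega> \<and> u q + w q \<le> u x0 + w x0"
  proof (rule limiting_exterior_point[OF lsc(1) B lsc(2) \<Omega>(1) q0 \<alpha>(1)])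
    show "(\<lambda>n. A (s n)) \<longlonglongrightarrow> A'" using s(2) by (simp add: o_def)
    show "(\<lambda>n. x (s n)) \<longlonglongrightarrow> x0" "(\<lambda>n. u (x (s n))) \<longlonglongrightarrow> u x0"
      "(\<lambda>n. y (s n)) \<longlonglongrightarrow> x0" "(\<lambda>n. w (y (s n))) \<longlonglongrightarrow> w x0"
      unfolding x_def y_def by (rule shift Xr Yr uX wY)+
    \<comment> \<open>The two right-hand sides cancel in the limit, since both sequences tend to a
      point of continuity of \<open>f\<close>.\<close>
    then have "(\<lambda>n. f (x (s n)) - f (y (s n))) \<longlonglongrightarrow> f x0 - f x0"
      using \<open>x0 \<in> \<Omega>\<close> in\<Omega>
      by (intro tendsto_diff continuous_on_tendsto_compose[OF assms(7)]) auto
    then show "(\<lambda>n. f (x (s n)) - f (y (s n))) \<longlonglongrightarrow> 0" by simp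
    show "0 \<le> A'" using A' by simp
    fix n z
    have "u (x (s n)) + w (y (s n)) + k (s n) * norm (x (s n) - y (s n))
        \<le> u x' + w y' + k (s n) * norm (x' - y')" for x' y'
      using min by (simp add: x_def y_def k_def)
    note incr = increments_at_doubled_min[OF \<alpha> u B u_lim w B' in\<Omega> this _ A_nonneg barrier]
    have "u z \<le> u (x (s n)) + (A (s n) + f (x (s n))) * norm (z - x (s n)) powr \<alpha>"
      by (rule incr) (simp add: k_def)
    also have "\<dots> \<le> u (x (s n)) + A (s n) * norm (z - x (s n)) powr \<alpha>"
      using assms(9) in\<Omega>(1) by (intro add_left_mono mult_right_mono) auto
    finally show "u z \<le> u (x (s n)) + A (s n) * norm (z - x (s n)) powr \<alpha>" .
    show "w z \<le> w (y (s n)) + (A (s n) + (f (x (s n)) - f (y (s n)))) * norm (z - y (s n)) powr \<alpha>"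
      using incr(2)[of z] by (simp add: k_def add_diff_eq)
  qed (rule A_near)
  \<comment> \<open>The exterior point found has a sum of at most \<open>t < 0\<close>.\<close>
  then show False using ext x0 t by force
qed

end
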